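(* Let $\preceq$ be a partial order on a finite index set $\mathcal{I}$ with $n$ elements, let $G=(V,E)$ be a directed graph corresponding to $\preceq$, and let $\lambda_F,\lambda_L,\lambda_{NI}\ge 0$. For a vector $\bm{y}\in\mathbb{R}^n$ indexed by $\mathcal{I}$, let $$\hat{\bm{\beta}}^{FLNI}(\bm{y},\lambda_F,\lambda_L,\lambda_{NI})=\underset{\bm{\beta}\in\mathbb{R}^n}{\arg\min}\ \tfrac12\|\bm{y}-\bm{\beta}\|_2^2+\lambda_F\sum_{(\bm{i},\bm{j})\in E}|\beta_{\bm{i}}-\beta_{\bm{j}}|+\lambda_L\|\bm{\beta}\|_1+\lambda_{NI}\sum_{(\bm{i},\bm{j})\in E}(\beta_{\bm{i}}-\beta_{\bm{j}})_+$$ and $\hat{\bm{\beta}}^{FNI}(\bm{y},\lambda_F,\lambda_{NI})=\hat{\bm{\beta}}^{FLNI}(\bm{y},\lambda_F,0,\lambda_{NI})$. Then $\hat{\bm{\beta}}^{FLNI}(\bm{y},\lambda_F,\lambda_L,\lambda_{NI})$ is the soft thresholding of $\hat{\bm{\beta}}^{FNI}(\bm{y},\lambda_F,\lambda_{NI})$, i.e. for every $\bm{i}\in\mathcal{I}$, $$\hat{\beta}^{FLNI}_{\bm{i}}(\bm{y},\lambda_F,\lambda_L,\lambda_{NI})=\begin{cases}\hat{\beta}^{FNI}_{\bm{i}}(\bm{y},\lambda_F,\lambda_{NI})-\lambda_L,&\text{if }\hat{\beta}^{FNI}_{\bm{i}}(\bm{y},\lambda_F,\lambda_{NI})\ge\lambda_L,\\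 0,&\text{if }|\hat{\beta}^{FNI}_{\bm{i}}(\bm{y},\lambda_F,\lambda_{NI})|\le\lambda_L,\\ \hat{\beta}^{FNI}_{\bm{i}}(\bm{y},\lambda_F,\lambda_{NI})+\lambda_L,&\text{if }\hat{\beta}^{FNI}_{\bm{i}}(\bm{y},\lambda_F,\lambda_{NI})\le-\lambda_L.\end{cases}$$
   Context: A vector $\bm{\beta}\in\mathbb{R}^n$ indexed by $\mathcal{I}$ is isotonic with respect to $\preceq$ if $\bm{j}_1\preceq\bm{j}_2$ implies $\beta_{\bm{j}_1}\le\beta_{\bm{j}_2}$. A directed graph $G=(V,E)$ corresponds to $\preceq$ if $V=\mathcal{I}$, $E$ is a set of ordered pairs of distinct elements of $\mathcal{I}$, and a vector $\bm{\beta}\in\mathbb{R}^n$ is isotonic with respect to $\preceq$ if and only if $\beta_{\bm{j}_1}\le\beta_{\bm{j}_2}$ for every $(\bm{j}_1,\bm{j}_2)\in E$. Notation: $x_+=x\cdot 1\{x>0\}$ for $x\in\mathbb{R}$; $\|\bm{\beta}\|_1=\sum_{\bm{i}\in\mathcal{I}}|\beta_{\bm{i}}|$. The minimizers are unique because the objective is strictly convex and coercive. *)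

theory Defs
  imports "HOL-Analysis.Analysis"
begin

text \<open>
  The finite index set is the universe of a finite type, and an order relation is the set of
  pairs \<open>(j\<^sub>1, j\<^sub>2)\<close> with \<open>j\<^sub>1\<close> below or equal to \<open>j\<^sub>2\<close>.
\<close>

definition isotonic :: "('i::finite \<times> 'i) set \<Rightarrow> real ^ 'i \<Rightarrow> bool" where
  "isotonic r \<beta> \<longleftrightarrow> (\<forall>(j1, j2) \<in> r. \<beta> $ j1 \<le> \<beta> $ j2)"

definition corresponds :: "'i::finite set \<Rightarrow> ('i \<times> 'i) set \<Rightarrow> ('i \<times> 'i) set \<Rightarrow> bool" where
  "corresponds V E r \<longleftrightarrow>
     V = UNIV \<and>
     (\<forall>(i, j) \<in> E. i \<noteq> j) \<and>
     (\<forall>\<beta>. isotonic r \<beta> \<longleftrightarrow> (\<forall>(j1, j2) \<in> E. \<beta> $ j1 \<le> \<beta> $ j2))"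

definition pos_part :: "real \<Rightarrow> real" where
  "pos_part x = x * of_bool (x > 0)"

definition l1_norm :: "real ^ 'i::finite \<Rightarrow> real" where
  "l1_norm \<beta> = (\<Sum>i\<in>UNIV. \<bar>\<beta> $ i\<bar>)"

definition FLNI_objective ::
  "('i::finite \<times> 'i) set \<Rightarrow> real ^ 'i \<Rightarrow> real \<Rightarrow> real \<Rightarrow> real \<Rightarrow> real ^ 'i \<Rightarrow> real" where
  "FLNI_objective E y lF lL lNI \<beta> =
     1 / 2 * (norm (y - \<beta>))\<^sup>2
     + lF * (\<Sum>(i, j)\<in>E. \<bar>\<beta> $ i - \<beta> $ j\<bar>)
     + lL * l1_norm \<beta>
     + lNI * (\<Sum>(i, j)\<in>E. pos_part (\<beta> $ i - \<beta> $ j))"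

definition FLNI ::
  "('i::finite \<times> 'i) set \<Rightarrow> real ^ 'i \<Rightarrow> real \<Rightarrow> real \<Rightarrow> real \<Rightarrow> real ^ 'i" where
  "FLNI E y lF lL lNI = (ARG_MIN (FLNI_objective E y lF lL lNI) \<beta>. True)"

definition FNI :: "('i::finite \<times> 'i) set \<Rightarrow> real ^ 'i \<Rightarrow> real \<Rightarrow> real \<Rightarrow> real ^ 'i" where
  "FNI E y lF lNI = FLNI E y lF 0 lNI"

text \<open>
  For nonnegative penalties the minimizer exists and is unique, so the choice made by
  \<open>arg_min\<close> is immaterial.
\<close>

lemma pos_part_eq_max: "pos_part x = max 0 x"
  by (auto simp: pos_part_def max_def)

lemma FLNI_objective_midpoint:
  fixes E :: "('i::finite \<times> 'i) set" and lF lL lNI :: real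
  assumes "lF \<ge> 0" "lL \<ge> 0" "lNI \<ge> 0"
  shows "FLNI_objective E y lF lL lNI ((1/2) *\<^sub>R (a + b))
     \<le> (FLNI_objective E y lF lL lNI a + FLNI_objective E y lF lL lNI b) / 2
        - (norm (a - b))\<^sup>2 / 8"
proof -
  let ?m = "(1/2) *\<^sub>R (a + b)"
  have q: "(norm (y - ?m))\<^sup>2 = ((norm (y - a))\<^sup>2 + (norm (y - b))\<^sup>2) / 2 - (norm (a - b))\<^sup>2 / 4"
    unfolding power2_norm_eq_inner
    by (simp add: inner_diff_left inner_diff_right inner_add_left inner_add_right
        inner_commute field_simps)
  have s1: "(\<Sum>(i, j)\<in>E. \<bar>?m $ i - ?m $ j\<bar>)
      \<le> ((\<Sum>(i, j)\<in>E. \<bar>a $ i - a $ j\<bar>) + (\<Sum>(i, j)\<in>E. \<bar>b $ i - b $ j\<bar>)) / 2"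
    unfolding sum.distrib[symmetric] sum_divide_distrib
    by (rule sum_mono) (auto simp: abs_if field_simps)
  have s2: "l1_norm ?m \<le> (l1_norm a + l1_norm b) / 2"
    unfolding l1_norm_def sum.distrib[symmetric] sum_divide_distrib
    by (rule sum_mono) (auto simp: abs_if field_simps)
  have s3: "(\<Sum>(i, j)\<in>E. pos_part (?m $ i - ?m $ j))
      \<le> ((\<Sum>(i, j)\<in>E. pos_part (a $ i - a $ j)) + (\<Sum>(i, j)\<in>E. pos_part (b $ i - b $ j))) / 2"
    unfolding sum.distrib[symmetric] sum_divide_distrib pos_part_eq_max
    by (rule sum_mono) (auto simp: max_def field_simps)
  show ?thesis
    using mult_left_mono[OF s1 assms(1)] mult_left_mono[OF s2 assms(2)]
      mult_left_mono[OF s3 assms(3)]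
    unfolding FLNI_objective_def q by (simp add: field_simps)
qed

lemma FLNI_objective_ex1_min:
  fixes E :: "('i::finite \<times> 'i) set" and lF lL lNI :: real
  assumes "lF \<ge> 0" "lL \<ge> 0" "lNI \<ge> 0"
  shows "\<exists>!\<beta>. is_arg_min (FLNI_objective E y lF lL lNI) (\<lambda>_. True) \<beta>"
proof -
  let ?f = "FLNI_objective E y lF lL lNI"
  have cont: "continuous_on S ?f" for S
    unfolding FLNI_objective_def l1_norm_def pos_part_eq_max case_prod_beta
    by (intro continuous_intros)
  have lower: "?f \<beta> \<ge> 1 / 2 * (norm (y - \<beta>))\<^sup>2" for \<beta>
    unfolding FLNI_objective_def l1_norm_def pos_part_eq_max
    using assms by (simp add: sum_nonneg case_prod_beta)
  define R where "R = 1 + 2 * ?f y"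
  have fy: "?f y \<ge> 0" using lower[of y] by simp
  have "\<exists>\<beta>\<in>cball y R. \<forall>\<gamma>\<in>cball y R. ?f \<beta> \<le> ?f \<gamma>"
    by (rule continuous_attains_inf) (use fy cont in \<open>auto simp: R_def\<close>)
  then obtain b where b: "\<And>\<gamma>. \<gamma> \<in> cball y R \<Longrightarrow> ?f b \<le> ?f \<gamma>" by blast
  have "?f b \<le> ?f \<gamma>" for \<gamma>
  proof (cases "\<gamma> \<in> cball y R")
    case True
    then show ?thesis by (rule b)
  next
    case False
    then have n: "norm (y - \<gamma>) \<ge> R" by (simp add: dist_norm)
    have "R \<le> R\<^sup>2" using fy by (simp add: R_def power2_eq_square algebra_simps)
    also have "\<dots> \<le> (norm (y - \<gamma>))\<^sup>2" by (rule power_mono) (use n fy in \<open>auto simp: R_def\<close>)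
    finally have "?f y \<le> ?f \<gamma>" using lower[of \<gamma>] by (simp add: R_def)
    moreover have "?f b \<le> ?f y" by (rule b) (use fy in \<open>simp add: R_def\<close>)
    ultimately show ?thesis by simp
  qed
  then have "is_arg_min ?f (\<lambda>_. True) b" by (simp add: is_arg_min_linorder)
  moreover have "a = c"
    if "is_arg_min ?f (\<lambda>_. True) a" "is_arg_min ?f (\<lambda>_. True) c" for a c
  proof -
    have "?f a \<le> ?f ((1/2) *\<^sub>R (a + c))" "?f a \<le> ?f c" "?f c \<le> ?f a"
      using that by (simp_all add: is_arg_min_linorder)
    moreover have "n \<le> 0" if "x \<le> m" "x \<le> z" "z \<le> x" "m \<le> (x + z) / 2 - n / 8"
      for x z m n :: real
      using that by (simp add: field_simps)
    ultimately have "(norm (a - c))\<^sup>2 \<le> 0"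
      using FLNI_objective_midpoint[OF assms, of E y a c] by blast
    then show ?thesis by simp
  qed
  ultimately show ?thesis by blast
qed

lemma FLNI_is_arg_min:
  fixes E :: "('i::finite \<times> 'i) set" and lF lL lNI :: real
  assumes "lF \<ge> 0" "lL \<ge> 0" "lNI \<ge> 0"
  shows "is_arg_min (FLNI_objective E y lF lL lNI) (\<lambda>_. True) (FLNI E y lF lL lNI)"
  unfolding FLNI_def arg_min_def
  using FLNI_objective_ex1_min[OF assms] by (rule someI_ex[OF ex1_implies_ex])

end

theory Submission
  imports Defs
begin

text \<open>
  Write \<open>P\<close> for the sum of the fusion and the nearly-isotonic penalty. It is sublinear
  (subadditive and positively homogeneous), and for a sublinear \<open>P\<close> the subgradient condition
  \<open>y - b \<in> \<partial>P(b)\<close>, which characterises the minimizer \<open>b\<close> of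
  \<open>\<parallel>y - \<beta>\<parallel>\<^sup>2 / 2 + P(\<beta>)\<close>, splits into two parts: the linear functional
  \<open>y - b\<close> lies below \<open>P\<close> everywhere and touches it at \<open>b\<close>
  (\<open>is_arg_min_prox_sublinear_iff\<close>). The full objective has the same shape, with \<open>P\<close>
  replaced by \<open>P + \<lambda>\<^sub>L \<parallel>\<cdot>\<parallel>\<^sub>1\<close>, so both minimizers are described in this way.

  Let \<open>b\<close> be the minimizer without the lasso term and decompose \<open>b = s + c\<close>, where \<open>c\<close> is
  \<open>b\<close> clipped to \<open>[-\<lambda>\<^sub>L, \<lambda>\<^sub>L]\<close> and \<open>s\<close> is the soft thresholding of \<open>b\<close>. Both are
  nondecreasing functions of \<open>b\<close>, so all differences between two coordinates keep their sign, and
  hence \<open>P(b) = P(s) + P(c)\<close> (\<open>edge_penalty_soft_clip\<close>). Since \<open>y - b\<close> touches \<open>P\<close> at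
  \<open>b\<close> and is below \<open>P\<close> at \<open>s\<close> and at \<open>c\<close>, it must touch \<open>P\<close> at \<open>s\<close> as well.
  Moreover \<open>c\<close> is below \<open>\<lambda>\<^sub>L \<parallel>\<cdot>\<parallel>\<^sub>1\<close> and touches it at \<open>s\<close>. Adding the two facts,
  \<open>y - s = (y - b) + c\<close> is below \<open>P + \<lambda>\<^sub>L \<parallel>\<cdot>\<parallel>\<^sub>1\<close> and touches it at \<open>s\<close>, so \<open>s\<close>
  is the minimizer of the full objective.
\<close>

lemma le_if_le_add_mult:
  fixes a b d :: real
  assumes "\<And>t. 0 < t \<Longrightarrow> t < 1 \<Longrightarrow> a \<le> b + t * d"
  shows "a \<le> b"
proof (rule tendsto_lowerbound)
  show "((\<lambda>t. b + t * d) \<longlongrightarrow> b) (at_right 0)"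
    by (auto intro!: tendsto_eq_intros)
  show "\<forall>\<^sub>F t in at_right 0. a \<le> b + t * d"
    using eventually_at_right_less eventually_at_right_real[OF zero_less_one]
    by (auto elim!: eventually_mono intro: assms)
qed simp

text \<open>
  This is Fermat's rule. Moving from a minimizer \<open>b\<close> in an arbitrary direction gives the
  inequality; moving from \<open>b\<close> towards the origin, where \<open>P\<close> decreases linearly, gives the
  reverse inequality at \<open>b\<close>. Conversely, the two conditions make the excess of the objective at
  \<open>\<gamma>\<close> over its value at \<open>b\<close> at least \<open>\<parallel>\<gamma> - b\<parallel>\<^sup>2 / 2\<close>.
\<close>

lemma is_arg_min_prox_sublinear_iff:
  fixes P :: "'a::real_inner \<Rightarrow> real"
  assumes subadd: "\<And>a b. P (a + b) \<le> P a + P b"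
    and homog: "\<And>t a. t \<ge> 0 \<Longrightarrow> P (t *\<^sub>R a) = t * P a"
  shows "is_arg_min (\<lambda>\<beta>. 1 / 2 * (norm (y - \<beta>))\<^sup>2 + P \<beta>) (\<lambda>_. True) b \<longleftrightarrow>
    (\<forall>\<gamma>. (y - b) \<bullet> \<gamma> \<le> P \<gamma>) \<and> (y - b) \<bullet> b = P b"
    (is "is_arg_min ?f _ b \<longleftrightarrow> ?below \<and> ?touch")
proof -
  have expand: "1 / 2 * (norm (y - (b + \<delta>)))\<^sup>2
      = 1 / 2 * (norm (y - b))\<^sup>2 - (y - b) \<bullet> \<delta> + 1 / 2 * (norm \<delta>)\<^sup>2" for \<delta>
    unfolding power2_norm_eq_inner
    by (simp add: inner_diff_left inner_diff_right inner_add_left inner_add_right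
        inner_commute field_simps)
  show ?thesis
  proof
    assume "is_arg_min ?f (\<lambda>_. True) b"
    then have "?f b \<le> ?f (b + \<delta>)" for \<delta>
      by (simp add: is_arg_min_linorder)
    then have min: "(y - b) \<bullet> \<delta> \<le> P (b + \<delta>) - P b + 1 / 2 * (norm \<delta>)\<^sup>2" for \<delta>
      using expand[of \<delta>] by (smt (verit))
    have below: "(y - b) \<bullet> \<gamma> \<le> P \<gamma>" for \<gamma>
    proof (rule le_if_le_add_mult)
      fix t :: real
      assume t: "0 < t"
      have "t * ((y - b) \<bullet> \<gamma>) \<le> t * (P \<gamma> + t * (1 / 2 * (norm \<gamma>)\<^sup>2))"
        using min[of "t *\<^sub>R \<gamma>"] subadd[of b "t *\<^sub>R \<gamma>"] t
        by (simp add: homog power_mult_distrib algebra_simps power2_eq_square)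
      then show "(y - b) \<bullet> \<gamma> \<le> P \<gamma> + t * (1 / 2 * (norm \<gamma>)\<^sup>2)"
        using t by simp
    qed
    have "P b \<le> (y - b) \<bullet> b"
    proof (rule le_if_le_add_mult)
      fix t :: real
      assume t: "0 < t" "t < 1"
      have "P (b + (- t) *\<^sub>R b) = (1 - t) * P b"
        using homog[of "1 - t" b] t by (simp add: algebra_simps)
      then have "t * P b \<le> t * ((y - b) \<bullet> b + t * (1 / 2 * (norm b)\<^sup>2))"
        using min[of "(- t) *\<^sub>R b"]
        by (simp add: power_mult_distrib algebra_simps power2_eq_square)
      then show "P b \<le> (y - b) \<bullet> b + t * (1 / 2 * (norm b)\<^sup>2)"
        using t by simp
    qed
    then show "?below \<and> ?touch"
      using below by (auto intro: antisym)
  next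
    assume r: "?below \<and> ?touch"
    have "?f b \<le> ?f \<gamma>" for \<gamma>
    proof -
      have "(y - b) \<bullet> (\<gamma> - b) \<le> P \<gamma> - P b"
        using r by (simp add: inner_diff_right)
      moreover have "0 \<le> 1 / 2 * (norm (\<gamma> - b))\<^sup>2"
        by simp
      moreover have "1 / 2 * (norm (y - \<gamma>))\<^sup>2
          = 1 / 2 * (norm (y - b))\<^sup>2 - (y - b) \<bullet> (\<gamma> - b) + 1 / 2 * (norm (\<gamma> - b))\<^sup>2"
        using expand[of "\<gamma> - b"] by (simp only: add_diff_eq add_diff_cancel_left')
      ultimately show ?thesis
        by linarith
    qed
    then show "is_arg_min ?f (\<lambda>_. True) b"
      by (simp add: is_arg_min_linorder)
  qed
qed

definition edge_penalty ::
  "('i::finite \<times> 'i) set \<Rightarrow> real \<Rightarrow> real \<Rightarrow> real ^ 'i \<Rightarrow> real" where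
  "edge_penalty E lF lNI \<beta> =
     (\<Sum>(i, j)\<in>E. lF * \<bar>\<beta> $ i - \<beta> $ j\<bar> + lNI * pos_part (\<beta> $ i - \<beta> $ j))"

lemma FLNI_objective_eq_edge_penalty:
  "FLNI_objective E y lF lL lNI =
     (\<lambda>\<beta>. 1 / 2 * (norm (y - \<beta>))\<^sup>2 + (edge_penalty E lF lNI \<beta> + lL * l1_norm \<beta>))"
  by (rule ext)
    (simp add: FLNI_objective_def edge_penalty_def sum_distrib_left sum.distrib case_prod_beta)

lemma pos_part_add_le: "pos_part (a + b) \<le> pos_part a + pos_part b"
  by (simp add: pos_part_eq_max)

lemma pos_part_mult: "t \<ge> 0 \<Longrightarrow> pos_part (t * a) = t * pos_part a"
  by (auto simp: pos_part_def zero_less_mult_iff)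

lemma edge_penalty_add_le:
  assumes "lF \<ge> 0" "lNI \<ge> 0"
  shows "edge_penalty E lF lNI (a + b) \<le> edge_penalty E lF lNI a + edge_penalty E lF lNI b"
  unfolding edge_penalty_def sum.distrib[symmetric] case_prod_beta
proof (rule sum_mono)
  fix e
  let ?a = "a $ fst e - a $ snd e" and ?b = "b $ fst e - b $ snd e"
  have "lF * \<bar>?a + ?b\<bar> \<le> lF * (\<bar>?a\<bar> + \<bar>?b\<bar>)"
    "lNI * pos_part (?a + ?b) \<le> lNI * (pos_part ?a + pos_part ?b)"
    using assms by (auto intro!: mult_left_mono pos_part_add_le)
  moreover have "(a + b) $ fst e - (a + b) $ snd e = ?a + ?b"
    by simp
  ultimately show "lF * \<bar>(a + b) $ fst e - (a + b) $ snd e\<bar>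
      + lNI * pos_part ((a + b) $ fst e - (a + b) $ snd e)
    \<le> lF * \<bar>?a\<bar> + lNI * pos_part ?a + (lF * \<bar>?b\<bar> + lNI * pos_part ?b)"
    by (simp only: distrib_left)
qed

lemma edge_penalty_scaleR:
  assumes "t \<ge> 0"
  shows "edge_penalty E lF lNI (t *\<^sub>R a) = t * edge_penalty E lF lNI a"
  unfolding edge_penalty_def sum_distrib_left case_prod_beta
proof (rule sum.cong)
  fix e
  let ?a = "a $ fst e - a $ snd e"
  have "(t *\<^sub>R a) $ fst e - (t *\<^sub>R a) $ snd e = t * ?a"
    by (simp add: algebra_simps)
  then show "lF * \<bar>(t *\<^sub>R a) $ fst e - (t *\<^sub>R a) $ snd e\<bar>
      + lNI * pos_part ((t *\<^sub>R a) $ fst e - (t *\<^sub>R a) $ snd e)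
    = t * (lF * \<bar>?a\<bar> + lNI * pos_part ?a)"
    using assms by (simp only: pos_part_mult abs_mult) (simp add: algebra_simps)
qed simp

lemma l1_norm_add_le: "l1_norm (a + b) \<le> l1_norm a + l1_norm b"
  unfolding l1_norm_def sum.distrib[symmetric] by (rule sum_mono) simp

lemma l1_norm_scaleR: "t \<ge> 0 \<Longrightarrow> l1_norm (t *\<^sub>R a) = t * l1_norm a"
  by (simp add: l1_norm_def abs_mult sum_distrib_left)

lemma is_arg_min_FLNI_objective_iff:
  fixes y b :: "real ^ 'i::finite"
  assumes "lF \<ge> 0" "lL \<ge> 0" "lNI \<ge> 0"
  shows "is_arg_min (FLNI_objective E y lF lL lNI) (\<lambda>_. True) b \<longleftrightarrow>
    (\<forall>\<gamma>. (y - b) \<bullet> \<gamma> \<le> edge_penalty E lF lNI \<gamma> + lL * l1_norm \<gamma>) \<and>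
    (y - b) \<bullet> b = edge_penalty E lF lNI b + lL * l1_norm b"
  unfolding FLNI_objective_eq_edge_penalty
proof (rule is_arg_min_prox_sublinear_iff)
  fix a b :: "real ^ 'i"
  have "lL * l1_norm (a + b) \<le> lL * (l1_norm a + l1_norm b)"
    using assms by (intro mult_left_mono l1_norm_add_le)
  then show "edge_penalty E lF lNI (a + b) + lL * l1_norm (a + b)
      \<le> edge_penalty E lF lNI a + lL * l1_norm a + (edge_penalty E lF lNI b + lL * l1_norm b)"
    using edge_penalty_add_le[OF assms(1,3), of E a b] by (simp add: distrib_left)
next
  fix t :: real and a :: "real ^ 'i"
  assume "t \<ge> 0"
  then show "edge_penalty E lF lNI (t *\<^sub>R a) + lL * l1_norm (t *\<^sub>R a)
      = t * (edge_penalty E lF lNI a + lL * l1_norm a)"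
    by (simp add: edge_penalty_scaleR l1_norm_scaleR algebra_simps)
qed

definition clip :: "real \<Rightarrow> real \<Rightarrow> real" where
  "clip L x = max (- L) (min L x)"

text \<open>
  Defining soft thresholding as the remainder of clipping builds in the decomposition
  on which the argument rests.
\<close>

definition soft :: "real \<Rightarrow> real \<Rightarrow> real" where
  "soft L x = x - clip L x"

text \<open>
  Clipping is nondecreasing and 1-Lipschitz, so \<open>soft L\<close> and \<open>clip L\<close> split each difference
  of coordinates into two parts of the same sign, on which both terms of the penalty are additive.
\<close>

lemma edge_penalty_soft_clip:
  assumes "L \<ge> 0"
  shows "edge_penalty E lF lNI b =
    edge_penalty E lF lNI (\<chi> i. soft L (b $ i)) + edge_penalty E lF lNI (\<chi> i. clip L (b $ i))"
proof -
  have abs: "\<bar>x - z\<bar> = \<bar>soft L x - soft L z\<bar> + \<bar>clip L x - clip L z\<bar>" for x z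
    using assms by (auto simp: soft_def clip_def max_def min_def)
  have pos: "pos_part (x - z) = pos_part (soft L x - soft L z) + pos_part (clip L x - clip L z)"
    for x z
    using assms by (auto simp: soft_def clip_def pos_part_eq_max max_def min_def)
  show ?thesis
    unfolding edge_penalty_def sum.distrib[symmetric] case_prod_beta
    by (rule sum.cong[OF refl], subst abs, subst pos) (simp add: distrib_left)
qed

lemma clip_inner_le:
  assumes "L \<ge> 0"
  shows "(\<chi> i. clip L (b $ i)) \<bullet> \<gamma> \<le> L * l1_norm \<gamma>"
  unfolding l1_norm_def inner_vec_def sum_distrib_left
proof (rule sum_mono)
  fix i
  have "\<bar>clip L (b $ i)\<bar> \<le> L"
    using assms by (simp add: clip_def)
  then have "\<bar>clip L (b $ i)\<bar> * \<bar>\<gamma> $ i\<bar> \<le> L * \<bar>\<gamma> $ i\<bar>"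
    by (rule mult_right_mono) simp
  then show "(\<chi> i. clip L (b $ i)) $ i \<bullet> \<gamma> $ i \<le> L * \<bar>\<gamma> $ i\<bar>"
    using abs_ge_self[of "clip L (b $ i) * \<gamma> $ i"] by (simp add: abs_mult)
qed

text \<open>Where \<open>soft L\<close> is nonzero, clipping has saturated at \<open>\<plusminus> L\<close> with the same sign.\<close>

lemma clip_inner_soft:
  assumes "L \<ge> 0"
  shows "(\<chi> i. clip L (b $ i)) \<bullet> (\<chi> i. soft L (b $ i)) = L * l1_norm (\<chi> i. soft L (b $ i))"
proof -
  have "clip L x * soft L x = L * \<bar>soft L x\<bar>" for x
    using assms by (auto simp: soft_def clip_def max_def min_def abs_if algebra_simps)
  then show ?thesis
    by (simp add: l1_norm_def inner_vec_def sum_distrib_left)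
qed

lemma is_arg_min_soft:
  fixes y b :: "real ^ 'i::finite"
  assumes nonneg: "lF \<ge> 0" "lL \<ge> 0" "lNI \<ge> 0"
    and min: "is_arg_min (FLNI_objective E y lF 0 lNI) (\<lambda>_. True) b"
  shows "is_arg_min (FLNI_objective E y lF lL lNI) (\<lambda>_. True) (\<chi> i. soft lL (b $ i))"
proof -
  define s where "s = (\<chi> i. soft lL (b $ i))"
  define c where "c = (\<chi> i. clip lL (b $ i))"
  let ?P = "edge_penalty E lF lNI"
  have below: "\<And>\<gamma>. (y - b) \<bullet> \<gamma> \<le> ?P \<gamma>" and touch: "(y - b) \<bullet> b = ?P b"
    using min is_arg_min_FLNI_objective_iff[OF nonneg(1) order_refl nonneg(3), of E y b] by auto
  have b: "b = s + c"
    by (simp add: s_def c_def soft_def vec_eq_iff)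
  have ys: "(y - s) \<bullet> \<gamma> = (y - b) \<bullet> \<gamma> + c \<bullet> \<gamma>" for \<gamma>
    unfolding b by (simp add: inner_add_left inner_diff_left)
  have "?P b = ?P s + ?P c"
    unfolding s_def c_def by (rule edge_penalty_soft_clip[OF nonneg(2)])
  moreover have "(y - b) \<bullet> b = (y - b) \<bullet> s + (y - b) \<bullet> c"
    by (subst (2) b) (rule inner_add_right)
  ultimately have touch_s: "(y - b) \<bullet> s = ?P s"
    using touch below[of s] below[of c] by linarith
  have "(y - s) \<bullet> \<gamma> \<le> ?P \<gamma> + lL * l1_norm \<gamma>" for \<gamma>
    using ys[of \<gamma>] below[of \<gamma>] clip_inner_le[OF nonneg(2), of b \<gamma>] by (simp add: c_def)
  moreover have "(y - s) \<bullet> s = ?P s + lL * l1_norm s"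
    using ys[of s] touch_s clip_inner_soft[OF nonneg(2), of b] by (simp add: c_def s_def)
  ultimately have "is_arg_min (FLNI_objective E y lF lL lNI) (\<lambda>_. True) s"
    by (simp add: is_arg_min_FLNI_objective_iff[OF nonneg])
  then show ?thesis
    by (simp add: s_def)
qed

theorem theorem2:
  fixes r :: "('i::finite \<times> 'i) set" and V :: "'i set" and E :: "('i \<times> 'i) set"
    and y :: "real ^ 'i" and lF lL lNI :: real and i :: 'i
  assumes "partial_order_on UNIV r"
    and "corresponds V E r"
    and "lF \<ge> 0" and "lL \<ge> 0" and "lNI \<ge> 0"
  shows "(FNI E y lF lNI $ i \<ge> lL \<longrightarrow>
            FLNI E y lF lL lNI $ i = FNI E y lF lNI $ i - lL) \<and>
         (\<bar>FNI E y lF lNI $ i\<bar> \<le> lL \<longrightarrow>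
            FLNI E y lF lL lNI $ i = 0) \<and>
         (FNI E y lF lNI $ i \<le> - lL \<longrightarrow>
            FLNI E y lF lL lNI $ i = FNI E y lF lNI $ i + lL)"
proof -
  note nonneg = assms(3-5)
  have "is_arg_min (FLNI_objective E y lF 0 lNI) (\<lambda>_. True) (FNI E y lF lNI)"
    unfolding FNI_def using nonneg by (intro FLNI_is_arg_min) simp_all
  then have "is_arg_min (FLNI_objective E y lF lL lNI) (\<lambda>_. True)
      (\<chi> i. soft lL (FNI E y lF lNI $ i))"
    by (rule is_arg_min_soft[OF nonneg])
  then have "FLNI E y lF lL lNI = (\<chi> i. soft lL (FNI E y lF lNI $ i))"
    using FLNI_objective_ex1_min[OF nonneg, of E y] FLNI_is_arg_min[OF nonneg, of E y] by blast
  then have "FLNI E y lF lL lNI $ i = soft lL (FNI E y lF lNI $ i)"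
    by simp
  then show ?thesis
    using nonneg by (auto simp: soft_def clip_def max_def min_def)
qed

end
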